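(* Let $S$ be a regular AG-groupoid with left identity and let $A=(\mu_A,\gamma_A)$ be an intuitionistic fuzzy set of $S$. Then $A$ is an intuitionistic fuzzy left ideal of $S$ if and only if $A$ is an intuitionistic fuzzy generalized bi-ideal of $S$.
   Context: An AG-groupoid is a non-empty set $S$ with a binary operation satisfying the left invertive law $(ab)c=(cb)a$ for all $a,b,c\in S$ (no associativity is assumed). A left identity is an element $e\in S$ with $ea=a$ for all $a\in S$. $S$ is regular if for every $a\in S$ there is $x\in S$ with $a=(ax)a$. An intuitionistic fuzzy set (IFS) of $S$ is a pair $A=(\mu_A,\gamma_A)$ of functions $\mu_A,\gamma_A:S\to[0,1]$ with $0\le \mu_A(x)+\gamma_A(x)\le 1$ for all $x\in S$. An IFS $A$ is an intuitionistic fuzzy left ideal if $\mu_A(xy)\ge\mu_A(y)$ and $\gamma_A(xy)\le\gamma_A(y)$ for all $x,y\in S$. It is an intuitionistic fuzzy generalized bi-ideal if $\mu_A((xa)y)\ge\min\{\mu_A(x),\mu_A(y)\}$ and $\gamma_A((xa)y)\le\max\{\gamma_A(x),\gamma_A(y)\}$ for all $x,a,y\in S$. *)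

theory Defs
  imports Complex_Main
begin

locale ag_groupoid =
  fixes S :: "'a set" and mult :: "'a \<Rightarrow> 'a \<Rightarrow> 'a" (infixl "\<cdot>" 70)
  assumes nonempty: "S \<noteq> {}"
    and closed: "\<lbrakk>a \<in> S; b \<in> S\<rbrakk> \<Longrightarrow> a \<cdot> b \<in> S"
    and left_invertive: "\<lbrakk>a \<in> S; b \<in> S; c \<in> S\<rbrakk> \<Longrightarrow> (a \<cdot> b) \<cdot> c = (c \<cdot> b) \<cdot> a"
begin

definition left_identity :: "'a \<Rightarrow> bool" where
  "left_identity e \<longleftrightarrow> e \<in> S \<and> (\<forall>a\<in>S. e \<cdot> a = a)"

definition regular :: bool where
  "regular \<longleftrightarrow> (\<forall>a\<in>S. \<exists>x\<in>S. a = (a \<cdot> x) \<cdot> a)"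

end

text \<open>
  A function from \<open>S\<close> to \<open>[0,1]\<close> is represented by a real-valued function on the ambient type
  of which only the values on \<open>S\<close> matter. The first component of a pair is the
  membership function \<open>\<mu>\<close>, the second the non-membership function \<open>\<gamma>\<close>.
\<close>

type_synonym 'a ifs = "('a \<Rightarrow> real) \<times> ('a \<Rightarrow> real)"

definition intuitionistic_fuzzy_set :: "'a set \<Rightarrow> 'a ifs \<Rightarrow> bool" where
  "intuitionistic_fuzzy_set S = (\<lambda>(\<mu>, \<gamma>).
     (\<forall>x\<in>S. \<mu> x \<in> {0..1} \<and> \<gamma> x \<in> {0..1} \<and> 0 \<le> \<mu> x + \<gamma> x \<and> \<mu> x + \<gamma> x \<le> 1))"

context ag_groupoid
begin

definition if_left_ideal :: "'a ifs \<Rightarrow> bool" where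
  "if_left_ideal = (\<lambda>(\<mu>, \<gamma>). intuitionistic_fuzzy_set S (\<mu>, \<gamma>) \<and>
     (\<forall>x\<in>S. \<forall>y\<in>S. \<mu> (x \<cdot> y) \<ge> \<mu> y \<and> \<gamma> (x \<cdot> y) \<le> \<gamma> y))"

definition if_generalized_bi_ideal :: "'a ifs \<Rightarrow> bool" where
  "if_generalized_bi_ideal = (\<lambda>(\<mu>, \<gamma>). intuitionistic_fuzzy_set S (\<mu>, \<gamma>) \<and>
     (\<forall>x\<in>S. \<forall>a\<in>S. \<forall>y\<in>S. \<mu> ((x \<cdot> a) \<cdot> y) \<ge> min (\<mu> x) (\<mu> y) \<and>
        \<gamma> ((x \<cdot> a) \<cdot> y) \<le> max (\<gamma> x) (\<gamma> y)))"

end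

end

theory Submission
  imports Defs
begin

text \<open>
  If \<open>y = (y z) y\<close>, then the left invertive law and \<open>a (b c) = b (a c)\<close> rewrite every product
  \<open>x y\<close> into the form \<open>(y t) y\<close>. The generalized bi-ideal inequality for \<open>(y t) y\<close> is then the
  left ideal inequality for \<open>x y\<close>.
\<close>

context ag_groupoid
begin

text \<open>The left invertive law swaps the outer factors of a triple product. It is applied to the
  whole product, then to its inner triple, then to the whole again.\<close>

lemma medial:
  assumes "a \<in> S" "b \<in> S" "c \<in> S" "d \<in> S"
  shows "(a \<cdot> b) \<cdot> (c \<cdot> d) = (a \<cdot> c) \<cdot> (b \<cdot> d)"
proof -
  have "(a \<cdot> b) \<cdot> (c \<cdot> d) = ((c \<cdot> d) \<cdot> b) \<cdot> a"
    using assms by (intro left_invertive closed)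
  also have "\<dots> = ((b \<cdot> d) \<cdot> c) \<cdot> a"
    using assms left_invertive[of c d b] by simp
  also have "\<dots> = (a \<cdot> c) \<cdot> (b \<cdot> d)"
    using assms by (intro left_invertive closed)
  finally show ?thesis .
qed

text \<open>Write \<open>a\<close> as \<open>e \<cdot> a\<close>, exchange the middle factors by
  \<open>medial\<close>, and absorb \<open>e\<close> into \<open>b\<close>.\<close>

lemma mult_left_commute:
  assumes "left_identity e" "a \<in> S" "b \<in> S" "c \<in> S"
  shows "a \<cdot> (b \<cdot> c) = b \<cdot> (a \<cdot> c)"
  using assms medial[of e a b c] by (simp add: left_identity_def)

text \<open>Expanding \<open>y\<close> once gives
  \<open>x \<cdot> y = ((z \<cdot> y) \<cdot> x) \<cdot> y\<close>. It remains to write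
  \<open>(z \<cdot> y) \<cdot> x\<close> with \<open>y\<close> as its left factor, which takes a
  second use of regularity.\<close>

lemma regular_mult_form:
  assumes e: "left_identity e" and "regular" and x: "x \<in> S" and y: "y \<in> S"
  obtains t where "t \<in> S" "x \<cdot> y = (y \<cdot> t) \<cdot> y"
proof -
  obtain z where z: "z \<in> S" and yzy: "y = (y \<cdot> z) \<cdot> y"
    using assms by (auto simp: regular_def)
  note [simp] = x y z closed
  \<comment> \<open>This expansion of \<open>z \<cdot> y\<close> supplies a factor
    \<open>y \<cdot> z\<close>. After multiplication by \<open>x\<close>, the invertive law moves
    that factor to the right end, where \<open>mult_left_commute\<close> can pull its
    \<open>y\<close> to the front.\<close>
  have "z \<cdot> y = z \<cdot> ((y \<cdot> z) \<cdot> y)"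
    using yzy by simp
  also have "\<dots> = (y \<cdot> z) \<cdot> (z \<cdot> y)"
    by (rule mult_left_commute[OF e]) simp_all
  finally have zy: "z \<cdot> y = (y \<cdot> z) \<cdot> (z \<cdot> y)" .
  have "(z \<cdot> y) \<cdot> x = ((y \<cdot> z) \<cdot> (z \<cdot> y)) \<cdot> x"
    using zy by simp
  also have "\<dots> = (x \<cdot> (z \<cdot> y)) \<cdot> (y \<cdot> z)"
    by (rule left_invertive) simp_all
  also have "\<dots> = y \<cdot> ((x \<cdot> (z \<cdot> y)) \<cdot> z)"
    by (rule mult_left_commute[OF e]) simp_all
  finally have zyx: "(z \<cdot> y) \<cdot> x = y \<cdot> ((x \<cdot> (z \<cdot> y)) \<cdot> z)" .
  have "x \<cdot> y = x \<cdot> ((y \<cdot> z) \<cdot> y)"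
    using yzy by simp
  also have "\<dots> = (y \<cdot> z) \<cdot> (x \<cdot> y)"
    by (rule mult_left_commute[OF e]) simp_all
  also have "\<dots> = ((x \<cdot> y) \<cdot> z) \<cdot> y"
    by (rule left_invertive) simp_all
  also have "(x \<cdot> y) \<cdot> z = (z \<cdot> y) \<cdot> x"
    by (rule left_invertive) simp_all
  finally have "x \<cdot> y = (y \<cdot> ((x \<cdot> (z \<cdot> y)) \<cdot> z)) \<cdot> y"
    unfolding zyx .
  then show ?thesis
    \<comment> \<open>The rotation puts the equation first, so that unification fixes
      \<open>t\<close> as \<open>(x \<cdot> (z \<cdot> y)) \<cdot> z\<close> before its membership
      in \<open>S\<close> is checked.\<close>
    by (rule that[rotated]) simp
qed

text \<open>The product \<open>(x \<cdot> a) \<cdot> y\<close> is a left multiple of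
  \<open>y\<close>, so the values at \<open>y\<close> bound it; \<open>min\<close> and
  \<open>max\<close> only weaken these bounds.\<close>

lemma if_left_ideal_imp_generalized_bi_ideal:
  assumes "if_left_ideal A"
  shows "if_generalized_bi_ideal A"
  using assms unfolding if_left_ideal_def if_generalized_bi_ideal_def
  by (auto simp: closed min.coboundedI2 max.coboundedI2)

lemma if_generalized_bi_ideal_imp_left_ideal:
  assumes e: "left_identity e" and reg: "regular" and A: "if_generalized_bi_ideal A"
  shows "if_left_ideal A"
proof -
  obtain \<mu> \<gamma> where A_eq: "A = (\<mu>, \<gamma>)"
    by (cases A)
  have "\<mu> (x \<cdot> y) \<ge> \<mu> y \<and> \<gamma> (x \<cdot> y) \<le> \<gamma> y" if x: "x \<in> S" and y: "y \<in> S" for x y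
  proof -
    obtain t where t: "t \<in> S" "x \<cdot> y = (y \<cdot> t) \<cdot> y"
      using regular_mult_form[OF e reg x y] .
    \<comment> \<open>Both outer factors are \<open>y\<close>, so \<open>min\<close> and
      \<open>max\<close> collapse to the values at \<open>y\<close>.\<close>
    have "\<mu> ((y \<cdot> t) \<cdot> y) \<ge> min (\<mu> y) (\<mu> y) \<and> \<gamma> ((y \<cdot> t) \<cdot> y) \<le> max (\<gamma> y) (\<gamma> y)"
      using A y t(1) unfolding A_eq if_generalized_bi_ideal_def by blast
    then show ?thesis
      by (simp add: t(2))
  qed
  then show ?thesis
    using A by (simp add: A_eq if_left_ideal_def if_generalized_bi_ideal_def)
qed

end

theorem corollary5:
  fixes S :: "'a set" and mult :: "'a \<Rightarrow> 'a \<Rightarrow> 'a" and A :: "'a ifs"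
  assumes "ag_groupoid S mult"
    and "\<exists>e. ag_groupoid.left_identity S mult e"
    and "ag_groupoid.regular S mult"
    and "intuitionistic_fuzzy_set S A"
  shows "ag_groupoid.if_left_ideal S mult A \<longleftrightarrow> ag_groupoid.if_generalized_bi_ideal S mult A"
  using assms ag_groupoid.if_left_ideal_imp_generalized_bi_ideal
    ag_groupoid.if_generalized_bi_ideal_imp_left_ideal
  by metis

end
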